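(* Let $q$ be a power of $2$, let $n$ be an odd positive integer, let $k$ be an integer satisfying $0<2k<n$ and $\gcd(k,n)=1$, and let $L_0$ be a $2$-linear polynomial over $\mathbb F_{q^n}$. Then $x^{q^k+1}+L_0(x^2)$ is a permutation polynomial of $\mathbb F_{q^n}$ if and only if $\mathrm{Tr}\big(L_0^\prime\big(u^{q^k+1}\big)u^{-2}\big)\ne1$ for every $u\in\mathbb F_{q^n}^*$.
   Context: $\mathrm{Tr}$ is the trace map of $\mathbb F_{q^n}/\mathbb F_q$. A $2$-linear polynomial over $\mathbb F_{q^n}$ is a polynomial of the form $L(x)=\sum_ia_ix^{2^i}$ with $a_i\in\mathbb F_{q^n}$; polynomials are identified with the maps they induce on $\mathbb F_{q^n}$ (so $x^{q^n}=x$). For such $L$, define $L^\prime(x)=\sum_i(a_ix)^{2^{-i}}$, where $x\mapsto x^{2^{-1}}$ denotes the inverse of the automorphism $x\mapsto x^2$ of $\mathbb F_{q^n}$ (and $x\mapsto x^{2^{-i}}$ is its $i$-th iterate). A permutation polynomial of $\mathbb F_{q^n}$ is a polynomial over $\mathbb F_{q^n}$ whose induced map on $\mathbb F_{q^n}$ is a bijection. *)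

theory Defs
  imports Main "HOL-Library.Cardinality" "HOL-Computational_Algebra.Polynomial"
begin

definition two_linear :: "'a::comm_ring_1 poly \<Rightarrow> bool" where
  "two_linear L \<longleftrightarrow> (\<exists>m a. L = (\<Sum>i<m. monom (a i) (2 ^ i)))"

definition perm_poly :: "'a::{field,finite} poly \<Rightarrow> bool" where
  "perm_poly f \<longleftrightarrow> bij (poly f)"

text \<open>The map $x \mapsto x^{2^{-i}}$; the inverse is a genuine one in characteristic 2, where
  squaring is a bijection of a finite field.\<close>

definition frob_inv :: "nat \<Rightarrow> 'a::{field,finite} \<Rightarrow> 'a" where
  "frob_inv i = (inv (\<lambda>y::'a. y ^ 2)) ^^ i"

text \<open>The map $L'$. Since $i < 2^i$, all nonzero coefficients at exponents $2^i$ have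
  $i \le \deg L$; the remaining summands vanish (see \<open>adjoint_map_sum_monom\<close>).\<close>

definition adjoint_map :: "'a::{field,finite} poly \<Rightarrow> 'a \<Rightarrow> 'a" where
  "adjoint_map L x = (\<Sum>i\<le>degree L. frob_inv i (coeff L (2 ^ i) * x))"

text \<open>The trace of the extension of degree \<open>n\<close> of the field with \<open>q\<close> elements, as the sum of the
  conjugates; its values are elements of the subfield, regarded inside the large field.\<close>

definition ff_trace :: "nat \<Rightarrow> nat \<Rightarrow> 'a::{field,finite} \<Rightarrow> 'a" where
  "ff_trace q n x = (\<Sum>i<n. x ^ (q ^ i))"

lemma frob_inv_0: "frob_inv i (0::'a::{field,finite}) = 0"
proof -
  have "inv (\<lambda>y::'a. y ^ 2) 0 = 0"
    unfolding inv_into_def by (rule some_equality) auto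
  then show ?thesis
    unfolding frob_inv_def by (induction i) auto
qed

lemma adjoint_map_sum_monom:
  fixes a :: "nat \<Rightarrow> 'a::{field,finite}"
  shows "adjoint_map (\<Sum>i<m. monom (a i) (2 ^ i)) x = (\<Sum>i<m. frob_inv i (a i * x))"
proof -
  define L where "L = (\<Sum>i<m. monom (a i) (2 ^ i))"
  have c: "coeff L (2 ^ i) = (if i < m then a i else 0)" for i
    by (simp add: L_def coeff_sum)
  have z: "coeff L (2 ^ i) = 0" if "degree L < i" for i
    using that less_exp[of i] by (intro coeff_eq_0) (rule less_trans)
  have "(\<Sum>i\<le>degree L. frob_inv i (coeff L (2 ^ i) * x))
      = (\<Sum>i\<in>{..degree L} \<union> {..<m}. frob_inv i (coeff L (2 ^ i) * x))"
    by (rule sum.mono_neutral_left) (auto simp: z frob_inv_0 not_le)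
  also have "\<dots> = (\<Sum>i<m. frob_inv i (coeff L (2 ^ i) * x))"
    by (rule sum.mono_neutral_right) (auto simp: c frob_inv_0)
  finally show ?thesis
    by (simp add: adjoint_map_def L_def[symmetric] c)
qed

end

theory Submission imports Defs begin

text \<open>Comparing \<open>x\<close> with \<open>x + a\<close> and substituting \<open>x = a z\<close>, the polynomial fails to be injective
  iff \<open>z^(q^k) + z + 1 = L\<^sub>0(a\<^sup>2) / a^(q^k+1)\<close> is solvable for some \<open>a \<noteq> 0\<close>. As \<open>gcd k n = 1\<close>,
  the image of \<open>z^(q^k) + z\<close> is the kernel of \<open>Tr\<close>, and \<open>Tr 1 = 1\<close>, so the condition for a
  permutation is \<open>Tr (L\<^sub>0(a\<^sup>2) / a^(q^k+1)) \<noteq> 1\<close> for all \<open>a \<noteq> 0\<close>.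

  The map \<open>L\<^sub>0'\<close> is adjoint to \<open>L\<^sub>0\<close> for the absolute trace form only, not for \<open>Tr\<close>. Hence the
  condition is tested on whole lines \<open>\<F>\<^sub>q a\<close>: the \<open>\<F>\<^sub>2\<close>-linear maps
  \<open>c \<mapsto> Tr (L\<^sub>0(c r) s) - c\<close> and \<open>d \<mapsto> Tr (L\<^sub>0'(d s) r) - d\<close> of \<open>\<F>\<^sub>q\<close> are adjoint to each other,
  so one is injective iff the other is.\<close>

subsection \<open>Frobenius maps of a finite field\<close>

text \<open>Multiplication by a nonzero \<open>x\<close> permutes the nonzero elements; comparing
  their products before and after gives \<open>x ^ (CARD('a) - 1) = 1\<close>.\<close>

lemma power_CARD_eq:
  fixes x :: "'a::{field,finite}"
  shows "x ^ CARD('a) = x"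
proof (cases "x = 0")
  case False
  have "(\<Prod>y\<in>UNIV-{0}. x * y) = \<Prod>(UNIV-{0::'a})"
    by (rule prod.reindex_bij_witness[of _ "\<lambda>y. y / x" "\<lambda>y. x * y"]) (use False in auto)
  then have "x ^ (CARD('a) - 1) = 1"
    by (simp add: prod.distrib card_Diff_singleton)
  then show ?thesis
    by (metis mult.right_neutral power_eq_if zero_less_card_finite less_numeral_extra(3))
qed simp

text \<open>An even power of \<open>-1\<close> is \<open>1\<close>, but the power with exponent
  \<open>CARD('a)\<close> is \<open>-1\<close> itself, so \<open>2 = 0\<close>.\<close>

lemma CHAR_eq_2_if_even_CARD:
  assumes "even CARD('a::{field,finite})"
  shows "CHAR('a) = 2"
proof -
  have "(1::'a) = -1"
    using power_CARD_eq[of "-1::'a"] assms by simp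
  then have "of_nat 2 = (0::'a)"
    by (metis add.right_inverse of_nat_numeral one_add_one)
  then have "CHAR('a) dvd 2"
    by (simp only: of_nat_eq_0_iff_char_dvd)
  then show ?thesis
    by (metis CHAR_not_1' One_nat_def dvd_refl prime_nat_iff two_is_prime_nat)
qed

lemma prime_CHAR_finite: "prime CHAR('a::{field,finite})"
  by (intro prime_CHAR_semidom finite_imp_CHAR_pos) simp

lemma power_CHAR_add:
  fixes x y :: "'a::{field,finite}"
  assumes "q = CHAR('a) ^ m"
  shows "(x + y) ^ q = x ^ q + y ^ q"
  using assms by (rule freshmans_dream'[OF prime_CHAR_finite])

lemma power_CHAR_diff:
  fixes x y :: "'a::{field,finite}"
  assumes "q = CHAR('a) ^ m"
  shows "(x - y) ^ q = x ^ q - y ^ q"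
  using power_CHAR_add[OF assms, of "x - y" y] by simp

lemma power_CHAR_inj:
  fixes x y :: "'a::{field,finite}"
  assumes "q = CHAR('a) ^ m" "x ^ q = y ^ q"
  shows "x = y"
  using power_CHAR_diff[OF assms(1), of x y] assms(2) by simp

lemma power_iterate_fixed:
  fixes x :: "'a::monoid_mult"
  assumes "x ^ q = x"
  shows "x ^ (q ^ i) = x"
  by (induction i) (simp_all add: assms power_mult)

subsection \<open>The trace\<close>

lemma ff_trace_0 [simp]: "0 < q \<Longrightarrow> ff_trace q n 0 = 0"
  by (auto simp: ff_trace_def intro!: sum.neutral)

lemma ff_trace_diff:
  fixes x y :: "'a::{field,finite}"
  assumes "q = CHAR('a) ^ m"
  shows "ff_trace q n (x - y) = ff_trace q n x - ff_trace q n y"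
proof -
  have "(x - y) ^ (q ^ i) = x ^ (q ^ i) - y ^ (q ^ i)" for i
    by (rule power_CHAR_diff[of _ "m * i"]) (simp add: assms power_mult)
  then show ?thesis
    by (simp add: ff_trace_def sum_subtractf)
qed

lemma ff_trace_add:
  fixes x y :: "'a::{field,finite}"
  assumes "q = CHAR('a) ^ m"
  shows "ff_trace q n (x + y) = ff_trace q n x + ff_trace q n y"
  using ff_trace_diff[OF assms, of n "x + y" y] by simp

lemma ff_trace_sum:
  fixes f :: "'b \<Rightarrow> 'a::{field,finite}"
  assumes "q = CHAR('a) ^ m"
  shows "ff_trace q n (\<Sum>i\<in>A. f i) = (\<Sum>i\<in>A. ff_trace q n (f i))"
proof -
  have "0 < q"
    using assms prime_CHAR_finite[where 'a='a] by (simp add: prime_gt_0_nat)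
  then show ?thesis
    by (induction A rule: infinite_finite_induct) (simp_all add: ff_trace_add[OF assms])
qed

lemma ff_trace_mult_fixed:
  fixes c x :: "'a::{field,finite}"
  assumes "c ^ q = c"
  shows "ff_trace q n (c * x) = c * ff_trace q n x"
  by (simp add: ff_trace_def power_mult_distrib power_iterate_fixed[OF assms] sum_distrib_left)

text \<open>Raising to the power \<open>q\<close> permutes the conjugates cyclically; the cycle
  closes because \<open>x ^ (q ^ n) = x\<close>.\<close>

lemma ff_trace_power:
  fixes x :: "'a::{field,finite}"
  assumes "CARD('a) = q ^ n"
  shows "ff_trace q n (x ^ q) = ff_trace q n x"
proof -
  have "ff_trace q n (x ^ q) = (\<Sum>i<n. x ^ (q ^ Suc i))"
    by (simp add: ff_trace_def flip: power_mult)
  also have "\<dots> = (\<Sum>i<Suc n. x ^ (q ^ i)) - x"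
    by (subst sum.lessThan_Suc_shift) simp
  also have "\<dots> = ff_trace q n x"
    using power_CARD_eq[of x] by (simp add: ff_trace_def assms)
  finally show ?thesis .
qed

lemma ff_trace_power_iterate:
  fixes x :: "'a::{field,finite}"
  assumes "CARD('a) = q ^ n"
  shows "ff_trace q n (x ^ (q ^ i)) = ff_trace q n x"
  by (induction i arbitrary: x) (simp_all add: ff_trace_power[OF assms] power_mult)

lemma ff_trace_fixed:
  fixes x :: "'a::{field,finite}"
  assumes "q = CHAR('a) ^ m" "CARD('a) = q ^ n"
  shows "ff_trace q n x ^ q = ff_trace q n x"
proof -
  have "ff_trace q n x ^ q = ff_trace q n (x ^ q)"
    unfolding ff_trace_def freshmans_dream_sum'[OF prime_CHAR_finite assms(1)]
    by (simp add: mult.commute flip: power_mult)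
  then show ?thesis
    by (simp add: ff_trace_power[OF assms(2)])
qed

text \<open>Transitivity of the trace: each exponent below \<open>n * m\<close> is
  \<open>i * m + j\<close> for exactly one pair \<open>i < n\<close>, \<open>j < m\<close>.\<close>

lemma ff_trace_ff_trace:
  fixes x :: "'a::{field,finite}"
  assumes "p = CHAR('a)"
  shows "ff_trace p m (ff_trace (p ^ m) n x) = ff_trace p (n * m) x"
proof -
  have "ff_trace p (n * m) x = (\<Sum>i<n. \<Sum>j = i * m..<i * m + m. x ^ (p ^ j))"
    unfolding ff_trace_def by (rule sum.nat_group[symmetric])
  also have "\<dots> = (\<Sum>i<n. \<Sum>j<m. x ^ (p ^ (i * m + j)))"
  proof (rule sum.cong[OF refl])
    fix i
    show "(\<Sum>j = i * m..<i * m + m. x ^ (p ^ j)) = (\<Sum>j<m. x ^ (p ^ (i * m + j)))"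
      using sum.shift_bounds_nat_ivl[of "\<lambda>j. x ^ (p ^ j)" 0 "i * m" m]
      by (simp add: atLeast0LessThan add.commute)
  qed
  also have "\<dots> = (\<Sum>i<n. ff_trace p m (x ^ ((p ^ m) ^ i)))"
    by (simp add: ff_trace_def power_add mult.commute flip: power_mult)
  also have "\<dots> = ff_trace p m (ff_trace (p ^ m) n x)"
    unfolding ff_trace_def[of "p ^ m"]
    by (rule ff_trace_sum[symmetric, of _ 1]) (simp add: assms)
  finally show ?thesis ..
qed

lemma card_ff_trace_kernel_le:
  assumes "2 \<le> q" "0 < n"
  shows "card {x::'a::{field,finite}. ff_trace q n x = 0} \<le> q ^ (n - 1)"
proof -
  define p where "p = (\<Sum>i<n. monom (1::'a) (q ^ i))"
  \<comment> \<open>The trace is the polynomial function of \<open>p\<close>, of degree at most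
    \<open>q ^ (n - 1)\<close>. As \<open>q\<close> is at least 2, only the summand
    \<open>i = 0\<close> reaches exponent 1, so \<open>p\<close> is nonzero and the degree bounds
    its roots.\<close>
  have "coeff p 1 = (\<Sum>i<n. if i = 0 then 1 else 0)"
    unfolding p_def coeff_sum
    by (rule sum.cong) (use assms in \<open>auto simp: power_eq_1_iff\<close>)
  also have "\<dots> = 1"
    using assms by simp
  finally have "p \<noteq> 0"
    by auto
  then have "card {x. poly p x = 0} \<le> degree p"
    by (rule card_poly_roots_bound)
  also have "\<dots> \<le> q ^ (n - 1)"
    unfolding p_def
    by (rule degree_sum_le)
      (use assms in \<open>auto intro!: order_trans[OF degree_monom_le] power_increasing\<close>)
  finally show ?thesis
    by (simp add: p_def ff_trace_def poly_sum poly_monom)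
qed

lemma ff_trace_nonzero:
  assumes "2 \<le> q" "0 < n" "CARD('a::{field,finite}) = q ^ n"
  shows "\<exists>x::'a. ff_trace q n x \<noteq> 0"
proof (rule ccontr)
  assume "\<nexists>x::'a. ff_trace q n x \<noteq> 0"
  then have "q ^ n \<le> q ^ (n - 1)"
    using card_ff_trace_kernel_le[of q n, where 'a='a] assms by simp
  then show False
    using assms power_strict_increasing[of "n - 1" n q] by simp
qed

text \<open>By Bezout some iterate of the \<open>q ^ k\<close>-power map is the
  \<open>q\<close>-power map composed with an iterate of the identity
  \<open>z ^ (q ^ n) = z\<close>.\<close>

lemma fixed_by_coprime_power:
  fixes z :: "'a::{field,finite}"
  assumes "z ^ (q ^ k) = z" "CARD('a) = q ^ n" "gcd k n = 1" "0 < k"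
  shows "z ^ q = z"
proof -
  obtain a b where ab: "k * a = n * b + 1"
    using bezout_nat[of k n] assms by auto
  have "z ^ (q ^ n) = z"
    using power_CARD_eq[of z] assms by simp
  then have "z ^ (q ^ (n * b)) = z"
    using power_iterate_fixed[of z "q ^ n" b] by (simp add: power_mult)
  moreover have "z ^ (q ^ (k * a)) = z"
    using power_iterate_fixed[of z "q ^ k" a] assms by (simp add: power_mult)
  ultimately show ?thesis
    by (simp add: ab power_mult mult.commute[of q])
qed

text \<open>Additive form of Hilbert's Theorem 90, by comparing cardinalities.\<close>

lemma range_frobenius_diff:
  assumes q: "q = CHAR('a::{field,finite}) ^ m" and m: "0 < m"
    and card: "CARD('a) = q ^ n" and k: "gcd k n = 1" "0 < k" and n: "0 < n"
  shows "range (\<lambda>z::'a. z ^ (q ^ k) - z) = {x. ff_trace q n x = 0}"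
proof (rule card_subset_eq)
  define h where "h = (\<lambda>z::'a. z ^ (q ^ k) - z)"
  have q2: "2 \<le> q"
    using power_increasing[of 1 m "CHAR('a)"] prime_ge_2_nat[OF prime_CHAR_finite[where 'a='a]] m
    by (simp add: q)
  \<comment> \<open>Two points of a fibre differ by an element fixed by the
    \<open>q ^ k\<close>-power map, hence by a root of \<open>z ^ q - z\<close>.\<close>
  have fibre: "card (h -` {y}) \<le> q" for y
  proof (cases "h -` {y} = {}")
    case False
    then obtain z where z: "h z = y"
      by auto
    have qk: "q ^ k = CHAR('a) ^ (m * k)"
      by (simp add: q power_mult)
    define p where "p = monom (1::'a) q - monom 1 1"
    have "coeff p q = 1"
      using q2 by (simp add: p_def)
    then have "p \<noteq> 0"
      by auto
    have "card (h -` {y}) = card ((\<lambda>w. w - z) ` (h -` {y}))"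
      by (rule card_image[symmetric]) (simp add: inj_on_def)
    also have "\<dots> \<le> card {x. poly p x = 0}"
    proof (rule card_mono)
      show "(\<lambda>w. w - z) ` (h -` {y}) \<subseteq> {x. poly p x = 0}"
      proof (rule image_subsetI)
        fix w assume "w \<in> h -` {y}"
        then have "(w - z) ^ (q ^ k) = w - z"
          using z by (simp add: h_def power_CHAR_diff[OF qk] algebra_simps)
        then have "(w - z) ^ q = w - z"
          using card k by (rule fixed_by_coprime_power)
        then show "w - z \<in> {x. poly p x = 0}"
          by (simp add: p_def poly_monom)
      qed
    qed simp
    also have "\<dots> \<le> degree p"
      using \<open>p \<noteq> 0\<close> by (rule card_poly_roots_bound)
    also have "\<dots> \<le> q"
      unfolding p_def
      by (rule degree_diff_le) (use q2 in \<open>auto intro: order_trans[OF degree_monom_le]\<close>)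
    finally show ?thesis .
  qed simp
  \<comment> \<open>Fibres of size at most \<open>q\<close> force at least
    \<open>q ^ (n - 1)\<close> values, which is already the upper bound for the size of the trace
    kernel.\<close>
  have "q ^ n = card (\<Union>y\<in>range h. h -` {y})"
    unfolding card[symmetric] by (rule arg_cong[of _ _ card]) auto
  also have "\<dots> \<le> (\<Sum>y\<in>range h. card (h -` {y}))"
    by (rule card_UN_le) simp
  also have "\<dots> \<le> card (range h) * q"
    using sum_bounded_above[of "range h" "\<lambda>y. card (h -` {y})" q] fibre by simp
  finally have "q ^ (n - 1) * q \<le> card (range h) * q"
    using n by (simp add: power_eq_if mult.commute)
  then have "q ^ (n - 1) \<le> card (range h)"
    using q2 by simp
  then have ge: "card {x::'a. ff_trace q n x = 0} \<le> card (range h)"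
    using card_ff_trace_kernel_le[OF q2 n, where 'a='a] by simp
  show sub: "range (\<lambda>z::'a. z ^ (q ^ k) - z) \<subseteq> {x. ff_trace q n x = 0}"
    by (auto simp: ff_trace_diff[OF q] ff_trace_power_iterate[OF card])
  show "card (range (\<lambda>z::'a. z ^ (q ^ k) - z)) = card {x::'a. ff_trace q n x = 0}"
    using ge card_mono[OF _ sub] by (simp add: h_def)
qed simp

subsection \<open>Duality\<close>

text \<open>If no such \<open>d\<close> existed, the map \<open>\<psi>\<close> below would be
  injective on the finite subfield \<open>F\<close>, hence onto. Adjointness makes its image
  orthogonal to \<open>c\<close> under the trace form of \<open>F\<close>, so the absolute trace
  would vanish identically. Stating this for abstract \<open>P\<close> and \<open>P'\<close> allows
  their roles to be exchanged later.\<close>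

lemma adjoint_fixed_point:
  fixes P P' :: "'a::{field,finite} \<Rightarrow> 'a"
  assumes p: "p = CHAR('a)" and m: "0 < m" and n: "0 < n" and card: "CARD('a) = (p ^ m) ^ n"
    and adj: "\<And>x y. ff_trace p (n * m) (P x * y) = ff_trace p (n * m) (x * P' y)"
    and diff: "\<And>x y. P' (x - y) = P' x - P' y"
    and c: "c \<noteq> 0" "c ^ (p ^ m) = c" "ff_trace (p ^ m) n (P (c * r) * s) = c"
  shows "\<exists>d. d \<noteq> 0 \<and> d ^ (p ^ m) = d \<and> ff_trace (p ^ m) n (P' (d * s) * r) = d"
proof (rule ccontr)
  assume contr: "\<not> ?thesis"
  define q where "q = p ^ m"
  define F where "F = {x::'a. x ^ q = x}"
  let ?T = "ff_trace q n" and ?t = "ff_trace p m" and ?t' = "ff_trace p (n * m)"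
  have q: "q = CHAR('a) ^ m"
    by (simp add: q_def p)
  have p1: "p = CHAR('a) ^ 1"
    by (simp add: p)
  have card': "CARD('a) = q ^ n"
    by (simp add: card q_def)
  have tower: "?t (?T x) = ?t' x" for x :: 'a
    unfolding q_def by (rule ff_trace_ff_trace[OF p])
  define \<psi> where "\<psi> d = ?T (P' (d * s) * r) - d" for d
  have F: "x - y \<in> F" if "x \<in> F" "y \<in> F" for x y
    using that by (simp add: F_def power_CHAR_diff[OF q])
  have T_F: "?T x \<in> F" for x
    by (simp add: F_def ff_trace_fixed[OF q card'])
  have cF: "c ^ q = c" "ff_trace q n (P (c * r) * s) = c"
    using c by (simp_all add: q_def)
  have \<psi>_diff: "\<psi> (x - y) = \<psi> x - \<psi> y" for x y
    by (simp add: \<psi>_def left_diff_distrib diff ff_trace_diff[OF q])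
  have "inj_on \<psi> F"
  proof (rule inj_onI)
    fix x y assume xy: "x \<in> F" "y \<in> F" "\<psi> x = \<psi> y"
    then have "\<psi> (x - y) = 0"
      by (simp add: \<psi>_diff)
    then show "x = y"
      using contr F[OF xy(1,2)] by (auto simp: \<psi>_def F_def q_def)
  qed
  moreover have "\<psi> ` F \<subseteq> F"
    by (auto simp: \<psi>_def intro: F T_F)
  ultimately have surj: "\<psi> ` F = F"
    by (simp add: endo_inj_surj)
  \<comment> \<open>Moving \<open>P'\<close> across the absolute trace form turns the first term of
    \<open>\<psi> d * c\<close> into \<open>d * Tr (P (c * r) * s)\<close>, which is
    \<open>d * c\<close> by the choice of \<open>c\<close> and cancels the second term.\<close>
  have orth: "?t (\<psi> d * c) = 0" if "d \<in> F" for d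
  proof -
    have d: "d ^ q = d"
      using that by (simp add: F_def)
    have "?t (?T (P' (d * s) * r) * c) = ?t (?T (c * (P' (d * s) * r)))"
      by (subst ff_trace_mult_fixed[OF cF(1)]) (simp only: mult.commute)
    also have "\<dots> = ?t' (c * r * P' (d * s))"
      by (simp only: tower ac_simps)
    also have "\<dots> = ?t' (P (c * r) * (d * s))"
      by (rule adj[symmetric])
    also have "\<dots> = ?t (?T (d * (P (c * r) * s)))"
      by (simp only: tower ac_simps)
    also have "\<dots> = ?t (d * c)"
      by (simp add: ff_trace_mult_fixed[OF d] cF)
    finally show ?thesis
      by (simp add: \<psi>_def left_diff_distrib ff_trace_diff[OF p1])
  qed
  \<comment> \<open>Dividing by \<open>c\<close> first makes \<open>c * \<psi> d\<close> equal to
    the trace of \<open>x\<close> down to \<open>F\<close>.\<close>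
  have "?t' x = 0" for x :: 'a
  proof -
    obtain d where d: "d \<in> F" "\<psi> d = ?T (x / c)"
      using surj T_F[of "x / c"] by (metis imageE)
    have "?t' x = ?t (?T (c * (x / c)))"
      using c by (simp add: tower)
    also have "\<dots> = ?t (\<psi> d * c)"
      unfolding ff_trace_mult_fixed[OF cF(1)] d(2) by (simp add: mult.commute)
    finally show ?thesis
      using orth[OF d(1)] by simp
  qed
  moreover have "2 \<le> p"
    using prime_ge_2_nat[OF prime_CHAR_finite[where 'a='a]] by (simp add: p)
  ultimately show False
    using ff_trace_nonzero[of p "n * m", where 'a='a] card m n
    by (simp add: mult.commute flip: power_mult)
qed

section \<open>The adjoint of a 2-linear polynomial\<close>

lemma frob_inv_power:
  fixes x :: "'a::{field,finite}"
  assumes "CHAR('a) = 2"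
  shows "frob_inv i x ^ (2 ^ i) = x"
proof -
  have "inj (\<lambda>y::'a. y ^ 2)"
    by (rule injI) (rule power_CHAR_inj[of _ 1], simp_all add: assms)
  then have s: "inv (\<lambda>y::'a. y ^ 2) y ^ 2 = y" for y
    by (intro surj_f_inv_f[where f = "\<lambda>y. y ^ 2"] finite_UNIV_inj_surj) simp_all
  show ?thesis
    by (induction i) (simp_all add: frob_inv_def power_mult s)
qed

lemma frob_inv_diff:
  fixes x y :: "'a::{field,finite}"
  assumes "CHAR('a) = 2"
  shows "frob_inv i (x - y) = frob_inv i x - frob_inv i y"
proof (rule power_CHAR_inj)
  show c: "(2::nat) ^ i = CHAR('a) ^ i"
    by (simp add: assms)
  show "frob_inv i (x - y) ^ (2 ^ i) = (frob_inv i x - frob_inv i y) ^ (2 ^ i)"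
    by (simp only: frob_inv_power[OF assms] power_CHAR_diff[OF c])
qed

lemma adjoint_map_diff:
  fixes L :: "'a::{field,finite} poly"
  assumes "CHAR('a) = 2"
  shows "adjoint_map L (x - y) = adjoint_map L x - adjoint_map L y"
  by (simp add: adjoint_map_def right_diff_distrib frob_inv_diff[OF assms] sum_subtractf)

lemma two_linear_diff:
  fixes L :: "'a::{field,finite} poly"
  assumes "CHAR('a) = 2" "two_linear L"
  shows "poly L (x - y) = poly L x - poly L y"
proof -
  obtain m a where L: "L = (\<Sum>i<m. monom (a i) (2 ^ i))"
    using assms(2) by (auto simp: two_linear_def)
  have "(x - y) ^ (2 ^ i) = x ^ (2 ^ i) - y ^ (2 ^ i)" for i
    by (rule power_CHAR_diff[of _ i]) (simp add: assms(1))
  then show ?thesis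
    by (simp add: L poly_sum poly_monom right_diff_distrib sum_subtractf)
qed

text \<open>Termwise, \<open>a i * x ^ (2 ^ i) * y\<close> is the \<open>2 ^ i\<close>-th power of
  \<open>x * frob_inv i (a i * y)\<close>, and the absolute trace is invariant under
  squaring.\<close>

lemma ff_trace_adjoint_map:
  fixes L :: "'a::{field,finite} poly"
  assumes char: "CHAR('a) = 2" and card: "CARD('a) = 2 ^ N" and "two_linear L"
  shows "ff_trace 2 N (poly L x * y) = ff_trace 2 N (x * adjoint_map L y)"
proof -
  obtain m a where L: "L = (\<Sum>i<m. monom (a i) (2 ^ i))"
    using assms(3) by (auto simp: two_linear_def)
  have c: "2 = CHAR('a) ^ 1"
    by (simp add: char)
  have "ff_trace 2 N (a i * x ^ (2 ^ i) * y) = ff_trace 2 N (x * frob_inv i (a i * y))" for i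
    using ff_trace_power_iterate[OF card, of "x * frob_inv i (a i * y)" i]
    by (simp add: power_mult_distrib frob_inv_power[OF char] ac_simps)
  then show ?thesis
    unfolding L adjoint_map_sum_monom
    by (simp add: poly_sum poly_monom sum_distrib_left sum_distrib_right ff_trace_sum[OF c])
qed

subsection \<open>The permutation criterion\<close>

lemma perm_poly_iff_trace:
  fixes L :: "'a::{field,finite} poly"
  assumes char: "CHAR('a) = 2" and q: "q = 2 ^ m" "0 < m" and card: "CARD('a) = q ^ n"
    and n: "odd n" and k: "gcd k n = 1" "0 < k" and L: "two_linear L"
  shows "perm_poly (monom 1 (q ^ k + 1) + pcompose L (monom 1 2)) \<longleftrightarrow>
    (\<forall>a. a \<noteq> 0 \<longrightarrow> ff_trace q n (poly L (a ^ 2) / a ^ (q ^ k + 1)) \<noteq> 1)"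
proof -
  define f where "f x = x ^ (q ^ k + 1) + poly L (x ^ 2)" for x
  define b where "b a = poly L (a ^ 2) / a ^ (q ^ k + 1)" for a
  have qc: "q = CHAR('a) ^ m" and qk: "q ^ k = CHAR('a) ^ (m * k)"
    by (simp_all add: q char power_mult)
  have two: "2 = CHAR('a) ^ 1"
    by (simp add: char)
  have n0: "0 < n"
    using n by (simp add: odd_pos)
  have minus: "- x = x" for x :: 'a
    by (rule uminus_CHAR_2[OF char])
  \<comment> \<open>The trace of 1 is \<open>n\<close> times 1, and \<open>n\<close> is odd in
    characteristic 2.\<close>
  have T1: "ff_trace q n (1::'a) = 1"
  proof -
    obtain j where "n = 2 * j + 1"
      using n by (rule oddE)
    then have "of_nat n = of_nat 2 * of_nat j + (1::'a)"
      by simp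
    also have "of_nat 2 = (0::'a)"
      using of_nat_CHAR[where 'a='a] unfolding char .
    finally have "of_nat n = (1::'a)"
      by simp
    then show ?thesis
      by (simp add: ff_trace_def)
  qed
  \<comment> \<open>The squares of \<open>a * z + a\<close> and \<open>a * z\<close> differ by
    \<open>a ^ 2\<close>, so the linear part contributes a constant. The signs are changed, using
    \<open>-1 = 1\<close>, to match the map of \<open>range_frobenius_diff\<close>.\<close>
  have f_mult: "f (a * z + a) - f (a * z) = a ^ (q ^ k + 1) * (z ^ (q ^ k) - z - 1 + b a)"
    if "a \<noteq> 0" for a z
  proof -
    have "poly L ((a * z + a) ^ 2) - poly L ((a * z) ^ 2) = poly L ((a * z + a) ^ 2 - (a * z) ^ 2)"
      by (simp add: two_linear_diff[OF char L])
    also have "\<dots> = a ^ (q ^ k + 1) * b a"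
      using that by (simp add: b_def power_CHAR_add[OF two])
    finally have lin: "poly L ((a * z + a) ^ 2) - poly L ((a * z) ^ 2) = a ^ (q ^ k + 1) * b a" .
    have "(a * z + a) ^ (q ^ k + 1) - (a * z) ^ (q ^ k + 1) = a ^ (q ^ k + 1) * (z ^ (q ^ k) + z + 1)"
      by (simp add: power_CHAR_add[OF qk] power_mult_distrib algebra_simps)
    also have "z ^ (q ^ k) + z + 1 = z ^ (q ^ k) - z - 1"
      using minus[of z] minus[of 1] by (metis diff_conv_add_uminus)
    finally have quad: "(a * z + a) ^ (q ^ k + 1) - (a * z) ^ (q ^ k + 1)
        = a ^ (q ^ k + 1) * (z ^ (q ^ k) - z - 1)" .
    show ?thesis
      unfolding f_def add_diff_add lin quad by (rule distrib_left[symmetric])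
  qed
  have solvable: "(\<exists>x. f (x + a) = f x) \<longleftrightarrow> ff_trace q n (b a) = 1" if a: "a \<noteq> 0" for a
  proof -
    have "(\<exists>x. f (x + a) = f x) \<longleftrightarrow> (\<exists>z. f (a * z + a) = f (a * z))"
    proof safe
      fix x assume "f (x + a) = f x"
      then show "\<exists>z. f (a * z + a) = f (a * z)"
        using a by (intro exI[of _ "x / a"]) simp
    qed auto
    also have "\<dots> \<longleftrightarrow> (\<exists>z. z ^ (q ^ k) - z - 1 + b a = 0)"
    proof -
      have "f (a * z + a) = f (a * z) \<longleftrightarrow> z ^ (q ^ k) - z - 1 + b a = 0" for z
        using f_mult[OF a, of z] a by (simp only: eq_iff_diff_eq_0[of "f _"]) simp
      then show ?thesis
        by (rule arg_cong[OF ext])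
    qed
    also have "\<dots> \<longleftrightarrow> 1 - b a \<in> range (\<lambda>z. z ^ (q ^ k) - z)"
    proof -
      have "z ^ (q ^ k) - z - 1 + b a = 0 \<longleftrightarrow> 1 - b a = z ^ (q ^ k) - z" for z
        by (auto simp: algebra_simps)
      then show ?thesis
        by (simp add: image_iff)
    qed
    also have "\<dots> \<longleftrightarrow> ff_trace q n (b a) = 1"
      unfolding range_frobenius_diff[OF qc q(2) card k n0]
      by (auto simp: ff_trace_diff[OF qc] T1)
    finally show ?thesis .
  qed
  have "perm_poly (monom 1 (q ^ k + 1) + pcompose L (monom 1 2)) \<longleftrightarrow> inj f"
  proof -
    have "poly (monom 1 (q ^ k + 1) + pcompose L (monom 1 2)) = f"
      by (rule ext) (simp add: f_def poly_monom poly_pcompose)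
    then show ?thesis
      using finite_UNIV_inj_surj[of f] by (auto simp only: perm_poly_def bij_def finite)
  qed
  also have "\<dots> \<longleftrightarrow> (\<forall>a. a \<noteq> 0 \<longrightarrow> \<not> (\<exists>x. f (x + a) = f x))"
  proof (intro iffI allI impI)
    fix a :: 'a assume "inj f" "a \<noteq> 0"
    then show "\<not> (\<exists>x. f (x + a) = f x)"
      by (simp add: inj_eq)
  next
    assume *: "\<forall>a. a \<noteq> 0 \<longrightarrow> \<not> (\<exists>x. f (x + a) = f x)"
    show "inj f"
    proof (rule injI)
      fix x y assume "f x = f y"
      then have "\<exists>z. f (z + (x - y)) = f z"
        by (intro exI[of _ y]) simp
      then have "x - y = 0"
        using *[rule_format, of "x - y"] by argo
      then show "x = y"
        by simp
    qed
  qed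
  also have "\<dots> \<longleftrightarrow> (\<forall>a. a \<noteq> 0 \<longrightarrow> ff_trace q n (b a) \<noteq> 1)"
    using solvable by simp
  finally show ?thesis
    by (simp add: b_def)
qed

theorem theorem9:
  fixes q n k :: nat and L0 :: "'a::{field,finite} poly"
  assumes q: "\<exists>m>0. q = 2 ^ m"
    and n: "odd n"
    and k: "0 < 2 * k" "2 * k < n" "gcd k n = 1"
    and field_card: "CARD('a) = q ^ n"
    and L0: "two_linear L0"
  shows "perm_poly (monom 1 (q ^ k + 1) + pcompose L0 (monom 1 2)) \<longleftrightarrow>
    (\<forall>u::'a. u \<noteq> 0 \<longrightarrow>
      ff_trace q n (adjoint_map L0 (u ^ (q ^ k + 1)) * u powi (-2)) \<noteq> 1)"
proof -
  obtain m where m: "0 < m" "q = 2 ^ m"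
    using q by auto
  have n0: "0 < n"
    using n by (simp add: odd_pos)
  have char: "CHAR('a) = 2"
    by (rule CHAR_eq_2_if_even_CARD) (use n0 m field_card in simp)
  have card: "CARD('a) = (2 ^ m) ^ n" "CARD('a) = 2 ^ (n * m)"
    using field_card m by (simp_all add: mult.commute flip: power_mult)
  have adj: "ff_trace 2 (n * m) (poly L0 x * y) = ff_trace 2 (n * m) (x * adjoint_map L0 y)" for x y
    by (rule ff_trace_adjoint_map[OF char card(2) L0])
  \<comment> \<open>The square root of an element of the subfield stays in the subfield, since
    squaring is injective and commutes with the \<open>q\<close>-power map.\<close>
  have root: "\<exists>e. e ^ q = e \<and> e ^ 2 = d" if "d ^ q = d" for d :: 'a
  proof -
    define e where "e = frob_inv 1 d"
    have e: "e ^ 2 = d"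
      using frob_inv_power[OF char, of 1 d] by (simp add: e_def)
    have "(e ^ q) ^ 2 = (e ^ 2) ^ q"
      by (simp add: mult.commute flip: power_mult)
    then have "(e ^ q) ^ 2 = e ^ 2"
      using that by (simp only: e)
    then have "e ^ q = e"
      by (rule power_CHAR_inj[of 2 1, rotated]) (simp add: char)
    with e show ?thesis by auto
  qed
  \<comment> \<open>On the subfield the exponent \<open>q ^ k + 1\<close> acts as squaring, so
    scaling by \<open>e\<close> multiplies both \<open>a ^ 2\<close> and
    \<open>a ^ (q ^ k + 1)\<close> by \<open>e ^ 2\<close>.\<close>
  have pow: "(e / a) ^ (q ^ k + 1) = e ^ 2 / a ^ (q ^ k + 1)" if "e ^ q = e" for e a :: 'a
    by (simp add: power_divide power_iterate_fixed[OF that] power2_eq_square)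
  have descend: "ff_trace q n (x / d) = 1" if "ff_trace q n x = d" "d ^ q = d" "d \<noteq> 0" for x d :: 'a
    using ff_trace_mult_fixed[of "1 / d" q n x] that by (simp add: power_divide)
  let ?A = "\<lambda>a. ff_trace q n (poly L0 (a ^ 2) / a ^ (q ^ k + 1)) = 1"
  let ?B = "\<lambda>u. ff_trace q n (adjoint_map L0 (u ^ (q ^ k + 1)) * u powi (-2)) = 1"
  \<comment> \<open>\<open>?A a\<close> says that \<open>c = 1\<close> is a fixed point for
    \<open>r = a ^ 2\<close> and \<open>s = 1 / a ^ (q ^ k + 1)\<close>. The dual fixed point
    \<open>d = e ^ 2\<close> is absorbed by \<open>u = e / a\<close>: then
    \<open>u ^ (q ^ k + 1) = d * s\<close> and \<open>u powi (-2) = r / d\<close>.\<close>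
  have "\<exists>u. u \<noteq> 0 \<and> ?B u" if a: "a \<noteq> 0" "?A a" for a
  proof -
    obtain d where d: "d \<noteq> 0" "d ^ q = d"
      "ff_trace q n (adjoint_map L0 (d * (1 / a ^ (q ^ k + 1))) * a ^ 2) = d"
      using adjoint_fixed_point[OF char[symmetric] m(1) n0 card(1) adj adjoint_map_diff[OF char],
          of 1 "a ^ 2" "1 / a ^ (q ^ k + 1)"] a m(2) by auto
    obtain e where e: "e ^ q = e" "e ^ 2 = d"
      using root[OF d(2)] by auto
    have "?B (e / a)"
      using descend[OF d(3,2,1)] unfolding pow[OF e(1)]
      by (simp add: e power_int_minus power_divide divide_inverse power_mult_distrib power_inverse ac_simps)
    moreover have "e / a \<noteq> 0"
      using d(1) e(2) a(1) by auto
    ultimately show ?thesis by blast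
  qed
  \<comment> \<open>The same argument with \<open>L0\<close> and its adjoint exchanged; now
    \<open>a = e / u\<close> gives \<open>a ^ 2 = d * u powi (-2)\<close>.\<close>
  moreover have "\<exists>a. a \<noteq> 0 \<and> ?A a" if u: "u \<noteq> 0" "?B u" for u
  proof -
    obtain d where d: "d \<noteq> 0" "d ^ q = d"
      "ff_trace q n (poly L0 (d * u powi (-2)) * u ^ (q ^ k + 1)) = d"
      using adjoint_fixed_point[OF char[symmetric] m(1) n0 card(1) _ two_linear_diff[OF char L0],
          where P = "adjoint_map L0" and c = 1 and r = "u ^ (q ^ k + 1)" and s = "u powi (-2)"] 
        u m(2) adj by (auto simp: mult.commute)
    obtain e where e: "e ^ q = e" "e ^ 2 = d"
      using root[OF d(2)] by auto
    have "?A (e / u)"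
      using descend[OF d(3,2,1)] unfolding pow[OF e(1)]
      by (simp add: e power_int_minus power_divide divide_inverse power_mult_distrib power_inverse ac_simps)
    moreover have "e / u \<noteq> 0"
      using d(1) e(2) u(1) by auto
    ultimately show ?thesis by blast
  qed
  ultimately have "(\<forall>a. a \<noteq> 0 \<longrightarrow> \<not> ?A a) \<longleftrightarrow> (\<forall>u. u \<noteq> 0 \<longrightarrow> \<not> ?B u)"
    by meson
  moreover have "0 < k"
    using k(1) by simp
  ultimately show ?thesis
    using perm_poly_iff_trace[OF char m(2,1) field_card n k(3) _ L0] by argo
qed

end
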